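(* Let $m\ge 1$ be an integer, and let $x_1,x_2,\dots,x_{2m}$ be given by $x_i=1$ for $1\le i\le m$ and $x_i=-1$ for $m+1\le i\le 2m$. Then $$\frac{1}{(2m)!}\sum_{\sigma}\max_{1\le k\le 2m-1}\left|\left(\sum_{i=1}^k x_{\sigma(i)}\right)^2-k\,\frac{2m-k}{2m-1}\right|^2\le 128\,m^2,$$ where the first sum is taken over all permutations $\sigma$ of $\{1,\dots,2m\}$. *)

theory Defs
  imports Complex_Main "HOL-Combinatorics.Permutations"
begin

end

(* Let n = 2 m, let S_k be the partial sum along the permutation and V_k = S_k^2 - k (n - k) / (n - 1).
   Given the first k values, x_{sigma(k+1)} has conditional mean - S_k / (n - k), which makes
   V_k / ((n - k) (n - k - 1)) a martingale for k <= n - 2. Doob's L2 inequality up to time m, where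
   the normalisation changes by a factor of about 4, reduces the maximum over k <= m to the second
   moment of V_m, known exactly from the fourth moment of S_m. Reversing the permutation maps V_k to
   V_{n-k} and so covers k > m. This argument needs m >= 3; for m <= 2 the trivial bound suffices. *)
theory Submission
  imports Defs
begin

section \<open>Averages over permutations, adapted functionals and partial sums\<close>

definition perm_avg :: "nat \<Rightarrow> ((nat \<Rightarrow> nat) \<Rightarrow> real) \<Rightarrow> real" where
  "perm_avg n F = (\<Sum>\<sigma> | \<sigma> permutes {1..n}. F \<sigma>) / fact n"

text \<open>Measurability with respect to the first \<open>k\<close> values. Quantifying over all
  functions, not only permutations, gives closure under pointwise operations without side
  conditions.\<close>

definition adapted :: "nat \<Rightarrow> ((nat \<Rightarrow> nat) \<Rightarrow> real) \<Rightarrow> bool" where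
  "adapted k F \<longleftrightarrow> (\<forall>\<sigma> \<tau>. (\<forall>i\<in>{1..k}. \<sigma> i = \<tau> i) \<longrightarrow> F \<sigma> = F \<tau>)"

definition psum :: "(nat \<Rightarrow> real) \<Rightarrow> nat \<Rightarrow> (nat \<Rightarrow> nat) \<Rightarrow> real" where
  "psum x k \<sigma> = (\<Sum>i = 1..k. x (\<sigma> i))"

definition dev :: "(nat \<Rightarrow> real) \<Rightarrow> nat \<Rightarrow> nat \<Rightarrow> (nat \<Rightarrow> nat) \<Rightarrow> real" where
  "dev x n k \<sigma> = (psum x k \<sigma>)\<^sup>2 - real k * ((real n - real k) / (real n - 1))"

text \<open>The conditional mean of \<open>dev\<close> at \<open>k + 1\<close> is
  \<open>(n - k - 2) / (n - k)\<close> times its value at \<open>k\<close>; the denominator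
  telescopes this factor away. It is nonzero for \<open>k\<close> up to
  \<open>n - 2\<close>.\<close>

definition mart :: "(nat \<Rightarrow> real) \<Rightarrow> nat \<Rightarrow> nat \<Rightarrow> (nat \<Rightarrow> nat) \<Rightarrow> real" where
  "mart x n k \<sigma> = dev x n k \<sigma> / ((real n - real k) * (real n - real k - 1))"

lemma perm_avg_add: "perm_avg n (\<lambda>\<sigma>. F \<sigma> + G \<sigma>) = perm_avg n F + perm_avg n G"
  by (simp add: perm_avg_def sum.distrib add_divide_distrib)

lemma perm_avg_cmult: "perm_avg n (\<lambda>\<sigma>. c * F \<sigma>) = c * perm_avg n F"
  by (simp add: perm_avg_def sum_distrib_left)

lemma perm_avg_diff: "perm_avg n (\<lambda>\<sigma>. F \<sigma> - G \<sigma>) = perm_avg n F - perm_avg n G"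
  by (simp add: perm_avg_def sum_subtractf diff_divide_distrib)

lemma perm_avg_sum: "perm_avg n (\<lambda>\<sigma>. \<Sum>i\<in>I. F i \<sigma>) = (\<Sum>i\<in>I. perm_avg n (F i))"
  unfolding perm_avg_def by (subst sum.swap) (simp add: sum_divide_distrib)

lemma perm_avg_const: "perm_avg n (\<lambda>\<sigma>. c) = c"
  by (simp add: perm_avg_def card_permutations[where n = n])

lemma perm_avg_cong:
  "(\<And>\<sigma>. \<sigma> permutes {1..n} \<Longrightarrow> F \<sigma> = G \<sigma>) \<Longrightarrow> perm_avg n F = perm_avg n G"
  by (simp add: perm_avg_def)

lemma perm_avg_mono:
  "(\<And>\<sigma>. \<sigma> permutes {1..n} \<Longrightarrow> F \<sigma> \<le> G \<sigma>) \<Longrightarrow> perm_avg n F \<le> perm_avg n G"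
  by (auto simp: perm_avg_def intro!: divide_right_mono sum_mono)

text \<open>Right translation preserves the uniform distribution; \<open>q\<close> will be a
  transposition or the reversal.\<close>

lemma perm_avg_compose:
  assumes "q permutes {1..n}"
  shows "perm_avg n (\<lambda>\<sigma>. F (\<sigma> \<circ> q)) = perm_avg n F"
  unfolding perm_avg_def using sum_permutations_compose_right[OF assms, of F] by simp

lemma adapted_psum: "k \<le> l \<Longrightarrow> adapted l (psum x k)"
  by (auto simp: adapted_def psum_def intro!: sum.cong)

lemma adapted_map: "adapted k F \<Longrightarrow> adapted k (\<lambda>\<sigma>. g (F \<sigma>))"
  unfolding adapted_def by metis

lemma adapted_mult: "adapted k F \<Longrightarrow> adapted k G \<Longrightarrow> adapted k (\<lambda>\<sigma>. F \<sigma> * G \<sigma>)"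
  unfolding adapted_def by metis

lemma adapted_mart:
  assumes "k \<le> l"
  shows "adapted l (mart x n k)"
  unfolding mart_def dev_def by (rule adapted_map[OF adapted_psum[OF assms]])

lemma adapted_Max:
  assumes "\<And>j. j \<le> k \<Longrightarrow> adapted k (F j)"
  shows "adapted k (\<lambda>\<sigma>. MAX j\<in>{..k}. F j \<sigma>)"
  unfolding adapted_def
proof (intro allI impI arg_cong[where f = Max] image_cong refl)
  fix \<sigma> \<tau> :: "nat \<Rightarrow> nat" and j
  assume "\<forall>i\<in>{1..k}. \<sigma> i = \<tau> i" "j \<in> {..k}"
  with assms[of j] show "F j \<sigma> = F j \<tau>" by (auto simp: adapted_def)
qed

section \<open>Conditional mean of the next value and the martingale property\<close>

lemma psum_Suc: "psum x (Suc k) \<sigma> = psum x k \<sigma> + x (\<sigma> (Suc k))"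
  by (simp add: psum_def)

lemma psum_split:
  assumes "k \<le> n"
  shows "psum x n \<sigma> = psum x k \<sigma> + (\<Sum>j = Suc k..n. x (\<sigma> j))"
  using sum.ub_add_nat[where m = 1 and n = k and p = "n - k" and g = "\<lambda>i. x (\<sigma> i)"] assms
  by (simp add: psum_def)

lemma psum_full:
  assumes "\<sigma> permutes {1..n}"
  shows "psum x n \<sigma> = (\<Sum>i = 1..n. x i)"
  using sum.permute[OF assms, of x] by (simp add: psum_def o_def)

text \<open>Swapping positions \<open>k + 1\<close> and \<open>j > k\<close> leaves \<open>F\<close> unchanged, so all the remaining
  positions contribute equally.\<close>
lemma perm_avg_next:
  assumes F: "adapted k F" and k: "k < n" and x: "(\<Sum>i = 1..n. x i) = 0"
  shows "perm_avg n (\<lambda>\<sigma>. F \<sigma> * x (\<sigma> (Suc k)))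
       = - perm_avg n (\<lambda>\<sigma>. F \<sigma> * psum x k \<sigma>) / (real n - real k)"
proof -
  have eq: "perm_avg n (\<lambda>\<sigma>. F \<sigma> * x (\<sigma> j)) = perm_avg n (\<lambda>\<sigma>. F \<sigma> * x (\<sigma> (Suc k)))"
    if j: "j \<in> {Suc k..n}" for j
  proof -
    let ?q = "transpose (Suc k) j"
    have q: "?q permutes {1..n}" using j k by (intro permutes_swap_id) auto
    have "F (\<sigma> \<circ> ?q) = F \<sigma>" for \<sigma>
      using F j unfolding adapted_def by (auto simp: transpose_def)
    then show ?thesis
      using perm_avg_compose[OF q, of "\<lambda>\<sigma>. F \<sigma> * x (\<sigma> (Suc k))"] by simp
  qed
  have "(real n - real k) * perm_avg n (\<lambda>\<sigma>. F \<sigma> * x (\<sigma> (Suc k)))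
      = (\<Sum>j = Suc k..n. perm_avg n (\<lambda>\<sigma>. F \<sigma> * x (\<sigma> j)))"
    using k by (subst sum.cong[OF refl eq]) (auto simp: of_nat_diff)
  \<comment> \<open>Since the whole vector sums to zero, the values after position \<open>k\<close>
    sum to minus the partial sum.\<close>
  also have "\<dots> = perm_avg n (\<lambda>\<sigma>. (- 1) * (F \<sigma> * psum x k \<sigma>))"
    unfolding perm_avg_sum[symmetric]
  proof (rule perm_avg_cong)
    fix \<sigma> assume "\<sigma> permutes {1..n}"
    then have "(\<Sum>j = Suc k..n. x (\<sigma> j)) = - psum x k \<sigma>"
      using psum_split[of k n x \<sigma>] k psum_full[of \<sigma> n x] x by simp
    then show "(\<Sum>j = Suc k..n. F \<sigma> * x (\<sigma> j)) = (- 1) * (F \<sigma> * psum x k \<sigma>)"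
      by (simp add: sum_distrib_left[symmetric])
  qed
  finally show ?thesis
    using k unfolding perm_avg_cmult by (simp add: field_simps)
qed

text \<open>With S the partial sum and y the next value, y^2 = 1 turns the increment into a constant
  times S (y + S / (n - k)), and the bracket has conditional mean zero.\<close>

lemma perm_avg_mart_increment:
  assumes F: "adapted k F" and k: "k + 2 < n"
    and x: "(\<Sum>i = 1..n. x i) = 0" and sq: "\<And>i. i \<in> {1..n} \<Longrightarrow> (x i)\<^sup>2 = 1"
  shows "perm_avg n (\<lambda>\<sigma>. F \<sigma> * (mart x n (Suc k) \<sigma> - mart x n k \<sigma>)) = 0"
proof -
  let ?N = "real n" and ?K = "real k"
  let ?d = "(?N - ?K - 1) * (?N - ?K - 2)"
  have pos: "?N - ?K > 0" "?N - ?K - 1 > 0" "?N - ?K - 2 > 0" "?N - 1 > 0" using k by auto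
  have "F \<sigma> * (mart x n (Suc k) \<sigma> - mart x n k \<sigma>)
      = 2 / ?d * (F \<sigma> * psum x k \<sigma> * x (\<sigma> (Suc k)) + 1 / (?N - ?K) * (F \<sigma> * psum x k \<sigma> * psum x k \<sigma>))"
    if s: "\<sigma> permutes {1..n}" for \<sigma>
  proof -
    have "(x (\<sigma> (Suc k)))\<^sup>2 = 1"
      using permutes_in_image[OF s, of "Suc k"] k by (intro sq) auto
    then have "dev x n (Suc k) \<sigma>
        = (psum x k \<sigma>)\<^sup>2 + 2 * psum x k \<sigma> * x (\<sigma> (Suc k)) + 1 - (?K + 1) * ((?N - ?K - 1) / (?N - 1))"
      by (simp add: dev_def psum_Suc power2_sum algebra_simps)
    moreover have "((S\<^sup>2 + 2 * S * y + 1 - (K + 1) * ((N - K - 1) / (N - 1))) / ((N - K - 1) * (N - K - 2))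
         - (S\<^sup>2 - K * ((N - K) / (N - 1))) / ((N - K) * (N - K - 1)))
        = 2 / ((N - K - 1) * (N - K - 2)) * (S * y + 1 / (N - K) * (S * S))"
      if "N - K > 0" "N - K - 1 > 0" "N - K - 2 > 0" "N - 1 > 0" for S y K N :: real
    proof -
      have nz: "N - K \<noteq> 0" "N - K - 1 \<noteq> 0" "N - K - 2 \<noteq> 0" "N - 1 \<noteq> 0" using that by auto
      \<comment> \<open>In these variables the denominators are \<open>p\<close>,
        \<open>p - 1\<close>, \<open>p - 2\<close> and \<open>q\<close>, and a polynomial identity
        remains.\<close>
      define p q where "p = N - K" and "q = N - 1"
      have N: "N = q + 1" "K = q + 1 - p" by (auto simp: p_def q_def)
      have nz': "p \<noteq> 0" "p - 1 \<noteq> 0" "p - 2 \<noteq> 0" "q \<noteq> 0" using nz N by auto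
      show ?thesis unfolding N using nz'
        by (simp add: divide_simps) algebra
    qed
    note this[OF pos, of "psum x k \<sigma>" "x (\<sigma> (Suc k))"]
    ultimately have "mart x n (Suc k) \<sigma> - mart x n k \<sigma>
       = 2 / ?d * (psum x k \<sigma> * x (\<sigma> (Suc k)) + 1 / (?N - ?K) * (psum x k \<sigma> * psum x k \<sigma>))"
      unfolding mart_def by (simp add: dev_def algebra_simps)
    then show ?thesis by (simp add: algebra_simps)
  qed
  then have "perm_avg n (\<lambda>\<sigma>. F \<sigma> * (mart x n (Suc k) \<sigma> - mart x n k \<sigma>))
     = 2 / ?d * (perm_avg n (\<lambda>\<sigma>. F \<sigma> * psum x k \<sigma> * x (\<sigma> (Suc k)))
        + 1 / (?N - ?K) * perm_avg n (\<lambda>\<sigma>. F \<sigma> * psum x k \<sigma> * psum x k \<sigma>))"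
    unfolding perm_avg_cmult[symmetric] perm_avg_add[symmetric]
    by (intro perm_avg_cong) auto
  also have "\<dots> = 0"
    \<comment> \<open>The adapted factor is here \<open>F\<close> times the partial sum; the two
      averages cancel.\<close>
    using perm_avg_next[OF adapted_mult[OF F adapted_psum[OF order.refl]], of n x] k x by simp
  finally show ?thesis .
qed

section \<open>Doob's L2 maximal inequality\<close>

lemma Max_atMost_Suc:
  fixes s :: "nat \<Rightarrow> 'a :: linorder"
  shows "(MAX j\<in>{..Suc k}. s j) = max (s (Suc k)) (MAX j\<in>{..k}. s j)"
  by (simp add: atMost_Suc)

text \<open>A deterministic form of Doob's inequality: for a martingale the subtracted sum has
  nonnegative mean.\<close>
lemma doob_pathwise:
  fixes s :: "nat \<Rightarrow> real"
  assumes nonneg: "\<And>k. s k \<ge> 0"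
  shows "(MAX j\<in>{..N}. s j)\<^sup>2
    \<le> 4 * (s N)\<^sup>2 - 4 * (\<Sum>k<N. (MAX j\<in>{..k}. s j) * (s (Suc k) - s k))"
proof -
  let ?A = "\<lambda>k. MAX j\<in>{..k}. s j"
  have *: "2 * (\<Sum>k<N. ?A k * (s (Suc k) - s k)) \<le> 2 * ?A N * s N - (?A N)\<^sup>2"
  proof (induction N)
    case 0
    then show ?case by (simp add: power2_eq_square)
  next
    case (Suc N)
    \<comment> \<open>Updating the running maximum either changes nothing or raises the right side
      by the square of \<open>s (Suc N) - ?A N\<close>.\<close>
    have "2 * ?A N * s (Suc N) - (?A N)\<^sup>2 \<le> 2 * ?A (Suc N) * s (Suc N) - (?A (Suc N))\<^sup>2"
    proof (cases "s (Suc N) \<le> ?A N")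
      case True
      then show ?thesis by (simp add: Max_atMost_Suc max_def)
    next
      case False
      then have "?A (Suc N) = s (Suc N)" by (simp add: Max_atMost_Suc)
      moreover have "0 \<le> (s (Suc N) - ?A N)\<^sup>2" by simp
      ultimately show ?thesis by (simp add: power2_eq_square algebra_simps)
    qed
    with Suc show ?case by (simp add: algebra_simps)
  qed
  \<comment> \<open>This square trades the mixed term \<open>?A N * s N\<close> for the factor
    4.\<close>
  have "0 \<le> (?A N - 2 * s N)\<^sup>2" by simp
  with * show ?thesis by (simp add: power2_eq_square algebra_simps)
qed

text \<open>The pathwise inequality is averaged for \<bar>M\<bar>; being a submartingale,
  \<bar>M\<bar> makes the subtracted sum nonnegative in mean.\<close>

lemma doob_perm_avg:
  assumes ad: "\<And>j k. j \<le> k \<Longrightarrow> adapted k (M j)"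
    and mart: "\<And>k F. k < N \<Longrightarrow> adapted k F \<Longrightarrow>
      perm_avg n (\<lambda>\<sigma>. F \<sigma> * (M (Suc k) \<sigma> - M k \<sigma>)) = 0"
  shows "perm_avg n (\<lambda>\<sigma>. (MAX j\<in>{..N}. \<bar>M j \<sigma>\<bar>)\<^sup>2) \<le> 4 * perm_avg n (\<lambda>\<sigma>. (M N \<sigma>)\<^sup>2)"
proof -
  let ?A = "\<lambda>k \<sigma>. MAX j\<in>{..k}. \<bar>M j \<sigma>\<bar>"
  have inc: "0 \<le> perm_avg n (\<lambda>\<sigma>. ?A k \<sigma> * (\<bar>M (Suc k) \<sigma>\<bar> - \<bar>M k \<sigma>\<bar>))" if k: "k < N" for k
  proof -
    \<comment> \<open>The sign is a subgradient of the absolute value at \<open>M k\<close>, so this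
      weight bounds increments of \<bar>M\<bar> below by increments of \<open>M\<close>.\<close>
    have "adapted k (\<lambda>\<sigma>. ?A k \<sigma> * sgn (M k \<sigma>))"
    proof (rule adapted_mult)
      show "adapted k (?A k)"
        by (rule adapted_Max) (rule adapted_map[OF ad])
      show "adapted k (\<lambda>\<sigma>. sgn (M k \<sigma>))"
        by (rule adapted_map[OF ad[OF order.refl]])
    qed
    from mart[OF k this]
    have "0 = perm_avg n (\<lambda>\<sigma>. ?A k \<sigma> * sgn (M k \<sigma>) * (M (Suc k) \<sigma> - M k \<sigma>))" by simp
    also have "\<dots> \<le> perm_avg n (\<lambda>\<sigma>. ?A k \<sigma> * (\<bar>M (Suc k) \<sigma>\<bar> - \<bar>M k \<sigma>\<bar>))"
    proof (rule perm_avg_mono)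
      fix \<sigma> :: "nat \<Rightarrow> nat"
      have "sgn (M k \<sigma>) * (M (Suc k) \<sigma> - M k \<sigma>) \<le> \<bar>M (Suc k) \<sigma>\<bar> - \<bar>M k \<sigma>\<bar>"
        by (auto simp: sgn_if)
      moreover have "0 \<le> ?A k \<sigma>"
        by (rule order.trans[of _ "\<bar>M k \<sigma>\<bar>"]) auto
      ultimately show "?A k \<sigma> * sgn (M k \<sigma>) * (M (Suc k) \<sigma> - M k \<sigma>)
          \<le> ?A k \<sigma> * (\<bar>M (Suc k) \<sigma>\<bar> - \<bar>M k \<sigma>\<bar>)"
        by (metis mult.assoc mult_left_mono)
    qed
    finally show ?thesis .
  qed
  have "perm_avg n (\<lambda>\<sigma>. (?A N \<sigma>)\<^sup>2) \<le> perm_avg n (\<lambda>\<sigma>. 4 * (M N \<sigma>)\<^sup>2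
      - 4 * (\<Sum>k<N. ?A k \<sigma> * (\<bar>M (Suc k) \<sigma>\<bar> - \<bar>M k \<sigma>\<bar>)))"
    using doob_pathwise[of "\<lambda>j. \<bar>M j _\<bar>" N] by (intro perm_avg_mono) simp
  also have "\<dots> = 4 * perm_avg n (\<lambda>\<sigma>. (M N \<sigma>)\<^sup>2)
      - 4 * (\<Sum>k<N. perm_avg n (\<lambda>\<sigma>. ?A k \<sigma> * (\<bar>M (Suc k) \<sigma>\<bar> - \<bar>M k \<sigma>\<bar>)))"
    by (simp only: perm_avg_diff perm_avg_cmult perm_avg_sum)
  also have "\<dots> \<le> 4 * perm_avg n (\<lambda>\<sigma>. (M N \<sigma>)\<^sup>2)"
    using sum_nonneg[of "{..<N}", OF inc] by simp
  finally show ?thesis .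
qed

section \<open>Second and fourth moments of the partial sums\<close>

lemma perm_avg_psum_sq:
  assumes "k \<le> n" "1 < n"
    and x: "(\<Sum>i = 1..n. x i) = 0" and sq: "\<And>i. i \<in> {1..n} \<Longrightarrow> (x i)\<^sup>2 = 1"
  shows "perm_avg n (\<lambda>\<sigma>. (psum x k \<sigma>)\<^sup>2) = real k * ((real n - real k) / (real n - 1))"
  using assms(1)
proof (induction k)
  case 0
  then show ?case by (simp add: psum_def perm_avg_const)
next
  case (Suc k)
  let ?a = "perm_avg n (\<lambda>\<sigma>. (psum x k \<sigma>)\<^sup>2)"
  have "perm_avg n (\<lambda>\<sigma>. (psum x (Suc k) \<sigma>)\<^sup>2)
      = perm_avg n (\<lambda>\<sigma>. (psum x k \<sigma>)\<^sup>2 + 2 * (psum x k \<sigma> * x (\<sigma> (Suc k))) + 1)"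
  proof (rule perm_avg_cong)
    fix \<sigma> assume s: "\<sigma> permutes {1..n}"
    have "(x (\<sigma> (Suc k)))\<^sup>2 = 1"
      using permutes_in_image[OF s, of "Suc k"] Suc.prems by (intro sq) auto
    then show "(psum x (Suc k) \<sigma>)\<^sup>2 = (psum x k \<sigma>)\<^sup>2 + 2 * (psum x k \<sigma> * x (\<sigma> (Suc k))) + 1"
      by (simp add: psum_Suc power2_sum algebra_simps)
  qed
  \<comment> \<open>The cross term averages to \<open>- ?a / (n - k)\<close>, a first-order
    recursion in \<open>k\<close> solved by the closed form.\<close>
  also have "\<dots> = ?a + 2 * (- ?a / (real n - real k)) + 1"
    using perm_avg_next[OF adapted_psum[OF order.refl], of k n x x] Suc.prems x
    by (simp add: perm_avg_add perm_avg_cmult perm_avg_const power2_eq_square)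
  also have "\<dots> = real (Suc k) * ((real n - real (Suc k)) / (real n - 1))"
  proof -
    have a: "?a = real k * ((real n - real k) / (real n - 1))" using Suc by simp
    have "real n - real k \<noteq> 0" "real n - 1 \<noteq> 0" using Suc.prems \<open>1 < n\<close> by auto
    then show ?thesis unfolding a by (simp add: divide_simps) (simp add: algebra_simps)
  qed
  finally show ?case .
qed

text \<open>The closed form sorts the expansion of the fourth power by coincidences among indices:
  products of two and of four distinct values have means \<open>- 1 / (N - 1)\<close> and
  \<open>3 / ((N - 1) * (N - 3))\<close>. The proof checks it through the recursion in
  \<open>k\<close>.\<close>

lemma perm_avg_psum_four:
  assumes "k \<le> n" "3 < n"
    and x: "(\<Sum>i = 1..n. x i) = 0" and sq: "\<And>i. i \<in> {1..n} \<Longrightarrow> (x i)\<^sup>2 = 1"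
  defines "K \<equiv> real k" and "N \<equiv> real n"
  shows "perm_avg n (\<lambda>\<sigma>. (psum x k \<sigma>) ^ 4) = K + 3 * K * (K - 1)
      - (4 * K * (K - 1) + 6 * K * (K - 1) * (K - 2)) / (N - 1)
      + 3 * K * (K - 1) * (K - 2) * (K - 3) / ((N - 1) * (N - 3))"
  using assms(1) unfolding K_def
proof (induction k)
  case 0
  then show ?case by (simp add: psum_def perm_avg_const)
next
  case (Suc k)
  let ?S = "psum x k"
  let ?y = "\<lambda>\<sigma> :: nat \<Rightarrow> nat. x (\<sigma> (Suc k))"
  let ?a = "perm_avg n (\<lambda>\<sigma>. (?S \<sigma>)\<^sup>2)" and ?b = "perm_avg n (\<lambda>\<sigma>. (?S \<sigma>) ^ 4)"
  have "perm_avg n (\<lambda>\<sigma>. (psum x (Suc k) \<sigma>) ^ 4)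
      = perm_avg n (\<lambda>\<sigma>. (?S \<sigma>) ^ 4 + 4 * ((?S \<sigma>) ^ 3 * ?y \<sigma>) + 6 * (?S \<sigma>)\<^sup>2 + 4 * (?S \<sigma> * ?y \<sigma>) + 1)"
  proof (rule perm_avg_cong)
    fix \<sigma> assume s: "\<sigma> permutes {1..n}"
    have "(?y \<sigma>)\<^sup>2 = 1"
      using permutes_in_image[OF s, of "Suc k"] Suc.prems by (intro sq) auto
    then have y: "?y \<sigma> * ?y \<sigma> = 1" by (simp add: power2_eq_square)
    \<comment> \<open>Higher powers of \<open>y\<close> are written through \<open>y * y\<close>, so
      that rewriting it to 1 leaves degree at most one in \<open>y\<close>.\<close>
    have "(S + y) ^ 4 = S ^ 4 + 4 * (S ^ 3 * y) + 6 * S\<^sup>2 * (y * y) + 4 * (S * y * (y * y)) + (y * y) * (y * y)"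
      for S y :: real by algebra
    from this[of "?S \<sigma>" "?y \<sigma>"]
    show "(psum x (Suc k) \<sigma>) ^ 4
        = (?S \<sigma>) ^ 4 + 4 * ((?S \<sigma>) ^ 3 * ?y \<sigma>) + 6 * (?S \<sigma>)\<^sup>2 + 4 * (?S \<sigma> * ?y \<sigma>) + 1"
      unfolding psum_Suc y by simp
  qed
  \<comment> \<open>\<open>perm_avg_next\<close> with the cube and with the partial sum itself
    handles the two terms linear in \<open>?y\<close>.\<close>
  also have "\<dots> = ?b + 4 * (- ?b / (N - real k)) + 6 * ?a + 4 * (- ?a / (N - real k)) + 1"
  proof -
    have "(\<lambda>\<sigma>. ?S \<sigma> ^ 3 * ?S \<sigma>) = (\<lambda>\<sigma>. ?S \<sigma> ^ 4)"
      by (simp add: eval_nat_numeral mult_ac)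
    then show ?thesis
      using perm_avg_next[OF adapted_psum[OF order.refl], of k n x x] Suc.prems x
        perm_avg_next[OF adapted_map[OF adapted_psum[OF order.refl]], of k n x "\<lambda>t. t ^ 3" x]
      by (simp add: perm_avg_add perm_avg_cmult perm_avg_const power2_eq_square N_def)
  qed
  also have "\<dots> = real (Suc k) + 3 * real (Suc k) * (real (Suc k) - 1)
      - (4 * real (Suc k) * (real (Suc k) - 1)
         + 6 * real (Suc k) * (real (Suc k) - 1) * (real (Suc k) - 2)) / (N - 1)
      + 3 * real (Suc k) * (real (Suc k) - 1) * (real (Suc k) - 2) * (real (Suc k) - 3)
        / ((N - 1) * (N - 3))"
  proof -
    have a: "?a = real k * ((N - real k) / (N - 1))"
      using perm_avg_psum_sq[of k n x] assms Suc.prems by simp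
    have nz: "N - real k \<noteq> 0" "N - 1 \<noteq> 0" "N - 3 \<noteq> 0"
      using Suc.prems \<open>3 < n\<close> by (auto simp: N_def)
    have id: "b + 4 * (- b / (N - K)) + 6 * a + 4 * (- a / (N - K)) + 1
        = (K + 1) + 3 * (K + 1) * K - (4 * (K + 1) * K + 6 * (K + 1) * K * (K - 1)) / (N - 1)
          + 3 * (K + 1) * K * (K - 1) * (K - 2) / ((N - 1) * (N - 3))"
      if "N - K \<noteq> 0" "N - 1 \<noteq> 0" "N - 3 \<noteq> 0" "a = K * ((N - K) / (N - 1))"
        "b = K + 3 * K * (K - 1) - (4 * K * (K - 1) + 6 * K * (K - 1) * (K - 2)) / (N - 1)
          + 3 * K * (K - 1) * (K - 2) * (K - 3) / ((N - 1) * (N - 3))" for K N a b :: real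
      unfolding that(4,5) using that(1-3) by (simp add: divide_simps) (simp add: algebra_simps)
    show ?thesis
      using id[OF nz a Suc.IH] Suc.prems by (simp add: algebra_simps)
  qed
  finally show ?case .
qed

section \<open>Reversal, and passage from deviations to the martingale\<close>

lemma rev_permutes: "(\<lambda>i. if i \<in> {1..n} then n + 1 - i else i) permutes {1..n :: nat}"
  by (rule bij_imp_permutes, rule bij_betw_byWitness[where f' = "\<lambda>i. n + 1 - i"]) auto

text \<open>The last \<open>n - k\<close> values sum to minus the first \<open>k\<close>; squaring
  removes the sign, and the centring is symmetric under exchanging \<open>k\<close> and
  \<open>n - k\<close>.\<close>

lemma dev_reverse:
  assumes s: "\<sigma> permutes {1..n}" and k: "k \<le> n" and x: "(\<Sum>i = 1..n. x i) = 0"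
  shows "dev x n k \<sigma> = dev x n (n - k) (\<sigma> \<circ> (\<lambda>i. if i \<in> {1..n} then n + 1 - i else i))"
proof -
  have "psum x (n - k) (\<sigma> \<circ> (\<lambda>i. if i \<in> {1..n} then n + 1 - i else i))
      = (\<Sum>i = 1..n - k. x (\<sigma> (n + 1 - i)))"
    unfolding psum_def by (intro sum.cong) auto
  also have "\<dots> = (\<Sum>j = Suc k..n. x (\<sigma> j))"
    using k by (intro sum.reindex_bij_witness[of _ "\<lambda>j. n + 1 - j" "\<lambda>j. n + 1 - j"]) auto
  also have "\<dots> = psum x n \<sigma> - psum x k \<sigma>"
    using psum_split[OF k, of x \<sigma>] by simp
  also have "\<dots> = - psum x k \<sigma>"
    using psum_full[OF s] x by simp
  finally show ?thesis
    using k by (simp add: dev_def of_nat_diff)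
qed

text \<open>The normalising factor \<open>(n - k) * (n - k - 1)\<close> is largest at
  \<open>k = 0\<close>.\<close>

lemma abs_dev_le_Max_mart:
  assumes "k \<le> m" "m + 1 < n"
  shows "\<bar>dev x n k \<sigma>\<bar> \<le> real n * (real n - 1) * (MAX j\<in>{..m}. \<bar>mart x n j \<sigma>\<bar>)"
proof -
  have pos: "0 < real n - real k" "0 < real n - real k - 1" using assms by auto
  then have "\<bar>dev x n k \<sigma>\<bar> = (real n - real k) * (real n - real k - 1) * \<bar>mart x n k \<sigma>\<bar>"
    by (simp add: mart_def abs_mult)
  also have "\<dots> \<le> real n * (real n - 1) * (MAX j\<in>{..m}. \<bar>mart x n j \<sigma>\<bar>)"
    using pos assms by (intro mult_mono) auto
  finally show ?thesis .
qed

section \<open>Second moment of the deviation at the midpoint\<close>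

lemma second_moment_bound:
  assumes m: "m \<ge> 3"
    and x: "(\<Sum>i = 1..2 * m. x i) = 0" and sq: "\<And>i. i \<in> {1..2 * m} \<Longrightarrow> (x i)\<^sup>2 = 1"
  shows "(2 * real m - 1)\<^sup>2 * perm_avg (2 * m) (\<lambda>\<sigma>. (dev x (2 * m) m \<sigma>)\<^sup>2)
    \<le> 4 * (real m)\<^sup>2 * (real m - 1)\<^sup>2"
proof -
  let ?M = "real m"
  \<comment> \<open>\<open>c\<close> is the exact mean of the squared sum, so the second moment
    sought is the variance \<open>b - c^2\<close>.\<close>
  define c where "c = ?M * ((2 * ?M - ?M) / (2 * ?M - 1))"
  have a: "perm_avg (2 * m) (\<lambda>\<sigma>. (psum x m \<sigma>)\<^sup>2) = c"
    using perm_avg_psum_sq[of m "2 * m" x] assms by (simp add: c_def)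
  define b where "b = perm_avg (2 * m) (\<lambda>\<sigma>. (psum x m \<sigma>) ^ 4)"
  have "perm_avg (2 * m) (\<lambda>\<sigma>. (dev x (2 * m) m \<sigma>)\<^sup>2)
      = perm_avg (2 * m) (\<lambda>\<sigma>. (psum x m \<sigma>) ^ 4 - 2 * c * (psum x m \<sigma>)\<^sup>2 + c\<^sup>2)"
      proof (rule perm_avg_cong)
    fix \<sigma>
    have "dev x (2 * m) m \<sigma> = (psum x m \<sigma>)\<^sup>2 - c" by (simp add: dev_def c_def)
    then show "(dev x (2 * m) m \<sigma>)\<^sup>2 = (psum x m \<sigma>) ^ 4 - 2 * c * (psum x m \<sigma>)\<^sup>2 + c\<^sup>2"
      by (simp add: power2_diff)
  qed
  also have "\<dots> = b - 2 * c * c + c\<^sup>2"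
    by (simp only: perm_avg_add perm_avg_diff perm_avg_cmult perm_avg_const a b_def)
  also have "\<dots> = b - c\<^sup>2"
    by (simp add: power2_eq_square)
  finally have v: "perm_avg (2 * m) (\<lambda>\<sigma>. (dev x (2 * m) m \<sigma>)\<^sup>2) = b - c\<^sup>2" .
  have b: "b = ?M + 3 * ?M * (?M - 1)
      - (4 * ?M * (?M - 1) + 6 * ?M * (?M - 1) * (?M - 2)) / (2 * ?M - 1)
      + 3 * ?M * (?M - 1) * (?M - 2) * (?M - 3) / ((2 * ?M - 1) * (2 * ?M - 3))"
    using perm_avg_psum_four[of m "2 * m" x] assms by (simp add: b_def)
  \<comment> \<open>Equality holds at \<open>m = 3\<close>; in \<open>t = m - 3\<close> the difference has nonnegative coefficients.\<close>
  define t where "t = ?M - 3"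
  have t: "t \<ge> 0" "?M = t + 3" using m by (auto simp: t_def)
  have nz: "2 * t + 5 \<noteq> 0" "2 * t + 3 \<noteq> 0" "2 * t + 3 > 0" using t by auto
  \<comment> \<open>The factor \<open>2 * t + 3\<close> is 2m - 3, the denominator of
    \<open>b\<close> that the square of 2m - 1 leaves uncleared.\<close>
  have "(2 * t + 3) * (4 * ?M\<^sup>2 * (?M - 1)\<^sup>2) - (2 * t + 3) * ((2 * ?M - 1)\<^sup>2 * (b - c\<^sup>2))
      = 144 * t + 240 * t ^ 2 + 148 * t ^ 3 + 40 * t ^ 4 + 4 * t ^ 5"
    unfolding b c_def t(2) using nz by (simp add: divide_simps) (simp add: algebra_simps eval_nat_numeral)
  also have "\<dots> \<ge> 0" using t by simp
  finally have "(2 * t + 3) * ((2 * ?M - 1)\<^sup>2 * (b - c\<^sup>2)) \<le> (2 * t + 3) * (4 * ?M\<^sup>2 * (?M - 1)\<^sup>2)"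
    by simp
  then show ?thesis using nz v by simp
qed

section \<open>The maximal bound, for large and for small \<open>m\<close>\<close>

theorem proposition5:
  fixes m :: nat and x :: "nat \<Rightarrow> real"
  assumes "m \<ge> 1"
    and "\<And>i. 1 \<le> i \<Longrightarrow> i \<le> m \<Longrightarrow> x i = 1"
    and "\<And>i. m + 1 \<le> i \<Longrightarrow> i \<le> 2 * m \<Longrightarrow> x i = - 1"
  shows "1 / fact (2 * m) *
      (\<Sum>\<sigma> | \<sigma> permutes {1..2 * m}.
         MAX k\<in>{1..2 * m - 1}.
           \<bar>(\<Sum>i = 1..k. x (\<sigma> i))\<^sup>2 - real k * ((2 * real m - real k) / (2 * real m - 1))\<bar>\<^sup>2)
    \<le> 128 * (real m)\<^sup>2"
proof -
  let ?n = "2 * m"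
  define E where "E = perm_avg ?n (\<lambda>\<sigma>. MAX k\<in>{1..?n - 1}. \<bar>dev x ?n k \<sigma>\<bar>\<^sup>2)"
  have sq: "(x i)\<^sup>2 = 1" if "i \<in> {1..?n}" for i
    using that assms(2)[of i] assms(3)[of i] by (cases "i \<le> m") auto
  have zero: "(\<Sum>i = 1..?n. x i) = 0"
  proof -
    have "(\<Sum>i = 1..?n. x i) = (\<Sum>i = 1..m. x i) + (\<Sum>i = m + 1..?n. x i)"
      using psum_split[of m "2 * m" x id] by (simp add: psum_def)
    also have "\<dots> = (\<Sum>i = 1..m. 1) + (\<Sum>i = m + 1..?n. - 1)"
      using assms(2,3) by (intro arg_cong2[where f = "(+)"] sum.cong) auto
    finally show ?thesis by simp
  qed
  have ne: "{1..?n - 1} \<noteq> {}" using \<open>m \<ge> 1\<close> by auto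
  have "E \<le> 128 * (real m)\<^sup>2"
  proof (cases "m \<ge> 3")
    case True
    let ?r = "\<lambda>i. if i \<in> {1..?n} then ?n + 1 - i else i"
    let ?A = "\<lambda>\<sigma>. MAX j\<in>{..m}. \<bar>mart x ?n j \<sigma>\<bar>"
    let ?c = "(real ?n * (real ?n - 1))\<^sup>2"
    \<comment> \<open>For each \<open>k\<close> one of the two terms suffices: the first if
      \<open>k\<close> is at most \<open>m\<close>, the reversed one otherwise. Adding them bounds
      the maximum over all \<open>k\<close>.\<close>
    have "E \<le> perm_avg ?n (\<lambda>\<sigma>. ?c * (?A \<sigma>)\<^sup>2 + ?c * (?A (\<sigma> \<circ> ?r))\<^sup>2)"
      unfolding E_def
    proof (rule perm_avg_mono)
      fix \<sigma> assume s: "\<sigma> permutes {1..?n}"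
      have "\<bar>dev x ?n k \<sigma>\<bar>\<^sup>2 \<le> ?c * (?A \<sigma>)\<^sup>2 + ?c * (?A (\<sigma> \<circ> ?r))\<^sup>2"
        if k: "k \<in> {1..?n - 1}" for k
      proof (cases "k \<le> m")
        case True
        then have "\<bar>dev x ?n k \<sigma>\<bar>\<^sup>2 \<le> ?c * (?A \<sigma>)\<^sup>2"
          unfolding power_mult_distrib[symmetric]
          using \<open>m \<ge> 3\<close> by (intro power_mono abs_dev_le_Max_mart) auto
        then show ?thesis by (simp add: add_increasing2)
      next
        case False
        have "\<bar>dev x ?n k \<sigma>\<bar>\<^sup>2 = \<bar>dev x ?n (?n - k) (\<sigma> \<circ> ?r)\<bar>\<^sup>2"
          using k by (subst dev_reverse[OF s _ zero]) auto
        also have "\<dots> \<le> ?c * (?A (\<sigma> \<circ> ?r))\<^sup>2"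
          unfolding power_mult_distrib[symmetric]
          using \<open>m \<ge> 3\<close> False by (intro power_mono abs_dev_le_Max_mart) auto
        finally show ?thesis by (simp add: add_increasing)
      qed
      then show "(MAX k\<in>{1..?n - 1}. \<bar>dev x ?n k \<sigma>\<bar>\<^sup>2) \<le> ?c * (?A \<sigma>)\<^sup>2 + ?c * (?A (\<sigma> \<circ> ?r))\<^sup>2"
        using ne by (subst Max_le_iff) auto
    qed
    also have "\<dots> = 2 * ?c * perm_avg ?n (\<lambda>\<sigma>. (?A \<sigma>)\<^sup>2)"
      using perm_avg_compose[OF rev_permutes[of ?n], of "\<lambda>\<sigma>. (?A \<sigma>)\<^sup>2"]
      by (simp only: perm_avg_add perm_avg_cmult)
    also have "perm_avg ?n (\<lambda>\<sigma>. (?A \<sigma>)\<^sup>2) \<le> 4 * perm_avg ?n (\<lambda>\<sigma>. (mart x ?n m \<sigma>)\<^sup>2)"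
    proof (rule doob_perm_avg)
      fix k F assume "k < m" "adapted k F"
      with True show "perm_avg ?n (\<lambda>\<sigma>. F \<sigma> * (mart x ?n (Suc k) \<sigma> - mart x ?n k \<sigma>)) = 0"
        by (intro perm_avg_mart_increment zero sq) auto
    qed (rule adapted_mart)
    \<comment> \<open>At time \<open>m\<close> the normalisation is \<open>m * (m - 1)\<close>,
      since \<open>n - m = m\<close>.\<close>
    also have "perm_avg ?n (\<lambda>\<sigma>. (mart x ?n m \<sigma>)\<^sup>2)
        = 1 / (real m * (real m - 1))\<^sup>2 * perm_avg ?n (\<lambda>\<sigma>. (dev x ?n m \<sigma>)\<^sup>2)"
      unfolding perm_avg_cmult[symmetric]
      by (rule perm_avg_cong) (simp add: mart_def power_divide)
    finally have "E \<le> 2 * ?c * (4 * (1 / (real m * (real m - 1))\<^sup>2 * perm_avg ?n (\<lambda>\<sigma>. (dev x ?n m \<sigma>)\<^sup>2)))"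
      by (simp add: mult_left_mono)
    \<comment> \<open>The 32 is 2 from the reversal, 4 from Doob and 4 from
      \<open>(2 * m)^2\<close>; the second moment bound supplies another 4, giving 128.\<close>
    also have "2 * ?c * (4 * (1 / (real m * (real m - 1))\<^sup>2 * perm_avg ?n (\<lambda>\<sigma>. (dev x ?n m \<sigma>)\<^sup>2)))
        = 32 / (real m - 1)\<^sup>2 * ((2 * real m - 1)\<^sup>2 * perm_avg ?n (\<lambda>\<sigma>. (dev x ?n m \<sigma>)\<^sup>2))"
      using True by (simp add: power_mult_distrib)
    also have "\<dots> \<le> 32 / (real m - 1)\<^sup>2 * (4 * (real m)\<^sup>2 * (real m - 1)\<^sup>2)"
      using second_moment_bound[OF True zero sq] by (intro mult_left_mono) auto
    also have "\<dots> = 128 * (real m)\<^sup>2"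
      using True by simp
    finally show ?thesis .
  next
    case False
    \<comment> \<open>The squared partial sum and its centring both lie between 0 and
      \<open>(2 * m - 1)^2\<close>, hence so does the absolute value of their difference.\<close>
    have "E \<le> perm_avg ?n (\<lambda>\<sigma>. (2 * real m - 1) ^ 4)"
      unfolding E_def
    proof (rule perm_avg_mono)
      fix \<sigma> assume s: "\<sigma> permutes {1..?n}"
      have "\<bar>dev x ?n k \<sigma>\<bar>\<^sup>2 \<le> (2 * real m - 1) ^ 4" if k: "k \<in> {1..?n - 1}" for k
      proof -
        have "\<bar>psum x k \<sigma>\<bar> \<le> (\<Sum>i = 1..k. 1)"
          unfolding psum_def
        proof (rule order.trans[OF sum_abs], rule sum_mono)
          fix i assume "i \<in> {1..k}"
          then have "\<sigma> i \<in> {1..?n}" using permutes_in_image[OF s, of i] k by auto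
          then show "\<bar>x (\<sigma> i)\<bar> \<le> 1" using sq[of "\<sigma> i"] by (simp add: abs_square_eq_1)
        qed
        then have 1: "\<bar>psum x k \<sigma>\<bar> \<le> 2 * real m - 1" using k by auto
        then have "(psum x k \<sigma>)\<^sup>2 \<le> (2 * real m - 1)\<^sup>2"
          using power_mono[OF 1, of 2] by simp
        moreover have "real k * ((2 * real m - real k) / (2 * real m - 1)) \<le> (2 * real m - 1)\<^sup>2"
        proof -
          have K: "1 \<le> real k" "real k \<le> 2 * real m - 1" using k by auto
          then have "real k * ((2 * real m - real k) / (2 * real m - 1)) \<le> (2 * real m - 1) * 1"
            by (intro mult_mono) auto
          also have "\<dots> \<le> (2 * real m - 1)\<^sup>2"
            using K by (simp add: power2_eq_square)
          finally show ?thesis .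
        qed
        moreover have "0 \<le> real k * ((2 * real m - real k) / (2 * real m - 1))" using k by auto
        ultimately have "\<bar>dev x ?n k \<sigma>\<bar> \<le> (2 * real m - 1)\<^sup>2"
          unfolding dev_def by (simp add: abs_le_iff) (smt (verit) zero_le_power2)
        from power_mono[OF this, of 2] show ?thesis by simp
      qed
      then show "(MAX k\<in>{1..?n - 1}. \<bar>dev x ?n k \<sigma>\<bar>\<^sup>2) \<le> (2 * real m - 1) ^ 4"
        using ne by (subst Max_le_iff) auto
    qed
    also have "\<dots> \<le> 128 * (real m)\<^sup>2"
    proof -
      \<comment> \<open>The comparisons are 1 with 128 and 81 with 512.\<close>
      have "m = 1 \<or> m = 2" using False \<open>m \<ge> 1\<close> by auto
      then show ?thesis by (auto simp: perm_avg_const)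
    qed
    finally show ?thesis .
  qed
  then show ?thesis
    by (simp add: E_def perm_avg_def dev_def psum_def)
qed

end
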